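(* Suppose that $\alpha_{i_0}>0$ and that $m_{i_0}$ is odd. Then there exists $N>0$ such that for every $a\in\mathbb{R}$ with $|a|>N$, $f_a^{(m_{i_0})}(\alpha_{i_0})<0$ and $f_a^{(m_{i_0+1})}(\alpha_{i_0+1})>0$, there exists an invariant set $\Lambda_a$ for $f_a$ contained in $(\alpha_{i_0-1},\alpha_{i_0})\cup(\alpha_{i_0+1},\alpha_{i_0+2})$ such that $f_a$ is hyperbolic on $\Lambda_a$ and $f_a:\Lambda_a\to\Lambda_a$ is topologically conjugate to $\sigma:\Sigma_2\to\Sigma_2$, where $\alpha_{i_0-1}=-\infty$ if $i_0=1$, and $\alpha_{i_0+2}=+\infty$ if $i_0=r-1$.
   Context: Let $g(x)=x^n+a_{n-1}x^{n-1}+\cdots+a_0$ be a real-coefficient polynomial whose distinct real zeros are $\alpha_1<\cdots<\alpha_r$ with $r\ge 2$, where $\alpha_i$ has multiplicity $m_i\ge 1$. Fix an index $i_0$ with $1\le i_0<r$. For a real parameter $a$ let $f_a(x)=a g(x)$; $f_a^{(m)}$ denotes the $m$-th derivative of $f_a$. A set $\Lambda$ is invariant for $f$ if $f(\Lambda)=\Lambda$. For a $C^1$ map $f:\mathbb{R}\to\mathbb{R}$, a compact invariant set $\Lambda$ is a hyperbolic set for $f$ (equivalently, $f$ is hyperbolic on $\Lambda$) if there are constants $C>0$ and $\lambda>1$ such that $|(f^n)'(x)|\ge C\lambda^n$ for all $x\in\Lambda$ and all $n\ge1$, where $f^n$ is the $n$-fold iterate. $\Sigma_2=\{(s_0,s_1,s_2,\dots):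 s_i\in\{1,2\}\}$ is the one-sided sequence space on two symbols with the metric $d(s,t)=\sum_{i\ge0}\delta(s_i,t_i)/2^i$ ($\delta(s_i,t_i)=1$ if $s_i\ne t_i$ and $0$ otherwise), and $\sigma(s_0,s_1,s_2,\dots)=(s_1,s_2,\dots)$ is the shift map. *)

theory Defs
  imports "HOL-Analysis.Analysis"
begin

definition invariant_set :: "('a \<Rightarrow> 'a) \<Rightarrow> 'a set \<Rightarrow> bool" where
  "invariant_set f \<Lambda> \<longleftrightarrow> f ` \<Lambda> = \<Lambda>"

text \<open>Hyperbolicity is only meant for \<open>C\<^sup>1\<close> maps of the line, so this is part of the predicate.\<close>

definition hyperbolic_set :: "(real \<Rightarrow> real) \<Rightarrow> real set \<Rightarrow> bool" where
  "hyperbolic_set f \<Lambda> \<longleftrightarrow>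
     f C1_differentiable_on UNIV \<and> compact \<Lambda> \<and> invariant_set f \<Lambda> \<and>
     (\<exists>C>0. \<exists>\<mu>>1. \<forall>x\<in>\<Lambda>. \<forall>n\<ge>1. \<bar>deriv (f ^^ n) x\<bar> \<ge> C * \<mu> ^ n)"

definition Sigma2 :: "(nat \<Rightarrow> nat) set" where
  "Sigma2 = {s. \<forall>i. s i \<in> {1, 2}}"

definition seq_dist :: "(nat \<Rightarrow> nat) \<Rightarrow> (nat \<Rightarrow> nat) \<Rightarrow> real" where
  "seq_dist s t = (\<Sum>i. (if s i \<noteq> t i then 1 else 0) / 2 ^ i)"

definition shift :: "(nat \<Rightarrow> nat) \<Rightarrow> nat \<Rightarrow> nat" where
  "shift s = (\<lambda>i. s (Suc i))"

lemma summable_seq_dist: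
  fixes s t :: "nat \<Rightarrow> nat"
  shows "summable (\<lambda>i. (if s i \<noteq> t i then 1 else 0) / 2 ^ i :: real)"
  by (rule summable_comparison_test'[OF summable_geometric[of "1/2::real"], of 0])
    (auto simp: power_one_over divide_simps)

interpretation Sigma2: Metric_space Sigma2 seq_dist
proof
  fix s t u :: "nat \<Rightarrow> nat"
  show "0 \<le> seq_dist s t"
    unfolding seq_dist_def by (intro suminf_nonneg summable_seq_dist) auto
  show "seq_dist s t = seq_dist t s"
    by (simp add: seq_dist_def eq_commute)
  show "seq_dist s t = 0 \<longleftrightarrow> s = t"
    unfolding seq_dist_def
    by (subst suminf_eq_zero_iff[OF summable_seq_dist]) (auto simp: fun_eq_iff)
  show "seq_dist s u \<le> seq_dist s t + seq_dist t u"
    unfolding seq_dist_def suminf_add[OF summable_seq_dist summable_seq_dist]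
    by (intro suminf_le summable_add summable_seq_dist) (auto simp: divide_simps)
qed

definition topologically_conjugate ::
    "'a topology \<Rightarrow> ('a \<Rightarrow> 'a) \<Rightarrow> 'b topology \<Rightarrow> ('b \<Rightarrow> 'b) \<Rightarrow> bool" where
  "topologically_conjugate X f Y g \<longleftrightarrow>
     (\<exists>h. homeomorphic_map X Y h \<and> (\<forall>x\<in>topspace X. h (f x) = g (h x)))"

text \<open>The zeros \<open>\<alpha> 1 < \<dots> < \<alpha> r\<close>, extended by \<open>\<alpha> 0 = -\<infinity>\<close> and \<open>\<alpha> (r + 1) = \<infinity>\<close>.\<close>

definition ext_zero :: "nat \<Rightarrow> (nat \<Rightarrow> real) \<Rightarrow> nat \<Rightarrow> ereal" where
  "ext_zero r \<alpha> i = (if i = 0 then -\<infinity> else if i = r + 1 then \<infinity> else ereal (\<alpha> i))"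

end

theory Submission
  imports Defs
begin

text \<open>
  Write \<open>p\<close> for the odd zero and \<open>q\<close> for the next one. The two derivative conditions fix the sign
  of the leading Taylor term of \<open>f\<^sub>a\<close> at \<open>p\<close> and \<open>q\<close>, so \<open>f\<^sub>a\<close> is positive just to the left of \<open>p\<close>
  (here \<open>m\<close> odd enters) and just to the right of \<open>q\<close>. Fix a small \<open>d\<close>. When \<open>\<bar>a\<bar>\<close> is large, \<open>f\<^sub>a\<close>
  exceeds \<open>q + d\<close> at \<open>p - d\<close> and at \<open>q + d\<close>, while it vanishes at \<open>p\<close> and \<open>q\<close>. Hence there are
  segments \<open>L\<close> in \<open>[p - d, p)\<close> and \<open>R\<close> in \<open>(q, q + d]\<close>, each of which is stretched over the whole
  interval \<open>[p - d, q + d]\<close>, and this interval contains \<open>L\<close> and \<open>R\<close>: a horseshoe with two full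
  branches.

  The zeros may be multiple, so \<open>f\<^sub>a'\<close> may be small near \<open>p\<close> and \<open>q\<close>; what is large there is the
  logarithmic derivative \<open>f\<^sub>a'/f\<^sub>a = g'/g\<close>, which behaves like \<open>m/(x - p)\<close> and does not depend on
  \<open>a\<close> (\<open>poly_near_root\<close>). On \<open>L\<close> and \<open>R\<close> the value of \<open>f\<^sub>a\<close> is at least \<open>p - d\<close>, and this is at
  least \<open>p/2\<close> because \<open>p > 0\<close>; so if \<open>d\<close> is chosen with \<open>\<bar>g'/g\<bar> \<ge> 4/p\<close>, then \<open>\<bar>f\<^sub>a'\<bar> \<ge> 2\<close> on both
  segments (\<open>steep_branch\<close>).

  It remains to see that an expanding horseshoe carries a full shift (locale
  \<open>expanding_horseshoe\<close>). \<open>\<Lambda>\<close> is the set of points whose orbits never leave \<open>L \<union> R\<close>, and the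
  conjugacy records which segment each iterate visits. It is injective since orbits with the same
  itinerary separate exponentially, surjective by compactness since every finite itinerary is
  realised, and continuous since \<open>L\<close> and \<open>R\<close> are disjoint and closed; by compactness of \<open>\<Lambda>\<close> it is a
  homeomorphism. Hyperbolicity is the chain rule.
\<close>

section \<open>Expanding horseshoes with two full branches\<close>

lemma seq_dist_le_if_agree:
  fixes s t :: "nat \<Rightarrow> nat"
  assumes "\<And>i. i < n \<Longrightarrow> s i = t i"
  shows "seq_dist s t \<le> 2 * (1/2) ^ n"
proof -
  let ?e = "\<lambda>i. (if s i \<noteq> t i then 1 else 0) / 2 ^ i :: real"
  have sums: "(\<lambda>i. (1/2::real) ^ n * (1/2) ^ i) sums ((1/2) ^ n * 2)"
    using sums_mult[OF geometric_sums[of "1/2::real"]] by simp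
  have "(\<Sum>i<n. ?e i) = 0"
    using assms by (intro sum.neutral) auto
  then have "seq_dist s t = (\<Sum>i. ?e (i + n))"
    unfolding seq_dist_def
    using suminf_split_initial_segment[OF summable_seq_dist[of s t], of n] by simp
  also have "\<dots> \<le> (\<Sum>i. (1/2) ^ n * (1/2) ^ i)"
    using summable_ignore_initial_segment[OF summable_seq_dist[of s t], of n] sums_summable[OF sums]
    by (intro suminf_le) (auto simp: power_add power_one_over field_simps)
  also have "\<dots> = 2 * (1/2) ^ n"
    using sums_unique[OF sums] by simp
  finally show ?thesis .
qed

text \<open>
  The setting in which itineraries determine points: \<open>covers\<close> lets every symbol follow every other,
  \<open>disjoint\<close> makes the symbol of a point well defined, and \<open>expands\<close>, together with convexity, makes
  \<open>F\<close> injective on each segment.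
\<close>

locale expanding_horseshoe =
  fixes F F' :: "real \<Rightarrow> real" and I :: "nat \<Rightarrow> real set" and \<mu> :: real
  assumes deriv: "(F has_real_derivative F' x) (at x)"
    and cont_deriv: "continuous_on UNIV F'"
    and compact_piece: "i \<in> {1, 2} \<Longrightarrow> compact (I i)"
    and convex_piece: "i \<in> {1, 2} \<Longrightarrow> convex (I i)"
    and nonempty: "I 1 \<noteq> {}"
    and disjoint: "I 1 \<inter> I 2 = {}"
    and covers: "i \<in> {1, 2} \<Longrightarrow> I 1 \<union> I 2 \<subseteq> F ` I i"
    and \<mu>: "\<mu> > 1"
    and expands: "x \<in> I 1 \<union> I 2 \<Longrightarrow> \<mu> \<le> \<bar>F' x\<bar>"
begin

definition \<Lambda> :: "real set" where
  "\<Lambda> = {x. \<forall>n. (F ^^ n) x \<in> I 1 \<union> I 2}"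

definition itinerary :: "real \<Rightarrow> nat \<Rightarrow> nat" where
  "itinerary x n = (if (F ^^ n) x \<in> I 1 then 1 else 2)"

lemma continuous_iterate: "continuous_on UNIV (F ^^ n)"
proof (induction n)
  case (Suc n)
  have "continuous_on UNIV F"
    using deriv DERIV_continuous_on has_field_derivative_at_within by blast
  then have "continuous_on UNIV (F \<circ> (F ^^ n))"
    using Suc by (intro continuous_on_compose) (auto intro: continuous_on_subset)
  then show ?case by (simp add: o_def)
qed (simp add: id_def)

lemma closed_iterate_vimage: "closed T \<Longrightarrow> closed ((F ^^ n) -` T)"
  using continuous_closed_vimage[of T "F ^^ n"] continuous_iterate continuous_on_eq_continuous_at by blast

lemma closed_piece: "i \<in> {1, 2} \<Longrightarrow> closed (I i)"
  by (simp add: compact_imp_closed compact_piece)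

lemma compact_\<Lambda>: "compact \<Lambda>"
proof -
  have eq: "\<Lambda> = (I 1 \<union> I 2) \<inter> (\<Inter>n. (F ^^ n) -` (I 1 \<union> I 2))"
    unfolding \<Lambda>_def using funpow_0 by (auto dest: spec[of _ 0])
  show ?thesis
    unfolding eq
    by (intro compact_Int_closed closed_INT ballI closed_iterate_vimage)
      (use compact_piece[of 1] compact_piece[of 2] closed_piece[of 1] closed_piece[of 2] in
        \<open>auto intro!: compact_Un closed_Un\<close>)
qed

lemma \<Lambda>_step: "x \<in> \<Lambda> \<longleftrightarrow> x \<in> I 1 \<union> I 2 \<and> F x \<in> \<Lambda>"
proof -
  have "(\<forall>n. (F ^^ n) x \<in> I 1 \<union> I 2) \<longleftrightarrow>
      (F ^^ 0) x \<in> I 1 \<union> I 2 \<and> (\<forall>n. (F ^^ Suc n) x \<in> I 1 \<union> I 2)"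
    by (metis not0_implies_Suc)
  then show ?thesis
    unfolding \<Lambda>_def by (simp add: funpow_swap1)
qed

lemma iterate_in_\<Lambda>: "x \<in> \<Lambda> \<Longrightarrow> (F ^^ n) x \<in> \<Lambda>"
proof (induction n)
  case (Suc n)
  then show ?case using \<Lambda>_step[of "(F ^^ n) x"] by simp
qed simp

lemma invariant: "invariant_set F \<Lambda>"
  unfolding invariant_set_def
proof (intro equalityI subsetI)
  fix y assume y: "y \<in> \<Lambda>"
  then obtain x where "x \<in> I 1" "y = F x"
    using \<Lambda>_step covers[of 1] by blast
  then show "y \<in> F ` \<Lambda>"
    using y \<Lambda>_step by blast
qed (use \<Lambda>_step in blast)

text \<open>
  The chain rule along an orbit. For orbits in \<open>\<Lambda>\<close> every factor is at least \<open>\<mu>\<close> in absolute value,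
  which is hyperbolicity with constant \<open>C = 1\<close>.
\<close>

lemma iterate_deriv:
  "((F ^^ n) has_real_derivative (\<Prod>k<n. F' ((F ^^ k) x))) (at x)"
proof (induction n)
  case (Suc n)
  have "((\<lambda>y. F ((F ^^ n) y)) has_real_derivative F' ((F ^^ n) x) * (\<Prod>k<n. F' ((F ^^ k) x))) (at x)"
    by (rule DERIV_chain2[OF deriv Suc])
  then show ?case by (simp add: o_def mult.commute)
qed (simp add: id_def)

lemma hyperbolic: "hyperbolic_set F \<Lambda>"
proof -
  have "\<mu> ^ n \<le> \<bar>deriv (F ^^ n) x\<bar>" if "x \<in> \<Lambda>" for x n
  proof -
    have "(\<Prod>k<n. \<mu>) \<le> (\<Prod>k<n. \<bar>F' ((F ^^ k) x)\<bar>)"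
      using that \<mu> expands by (intro prod_mono) (auto simp: \<Lambda>_def)
    then show ?thesis
      using DERIV_imp_deriv[OF iterate_deriv, of n x] by (simp add: abs_prod)
  qed
  then have "\<exists>\<nu>>1. \<forall>x\<in>\<Lambda>. \<forall>n\<ge>1. \<bar>deriv (F ^^ n) x\<bar> \<ge> 1 * \<nu> ^ n"
    using \<mu> by (intro exI[of _ \<mu>]) simp
  then have "\<exists>C>0. \<exists>\<nu>>1. \<forall>x\<in>\<Lambda>. \<forall>n\<ge>1. \<bar>deriv (F ^^ n) x\<bar> \<ge> C * \<nu> ^ n"
    using zero_less_one by blast
  moreover have "F C1_differentiable_on UNIV"
    unfolding C1_differentiable_on_def
    using deriv cont_deriv by (auto simp: has_real_derivative_iff_has_vector_derivative)
  ultimately show ?thesis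
    unfolding hyperbolic_set_def using compact_\<Lambda> invariant by blast
qed

lemma itinerary_in_Sigma2: "itinerary x \<in> Sigma2"
  by (auto simp: itinerary_def Sigma2_def)

lemma in_piece_itinerary: "x \<in> \<Lambda> \<Longrightarrow> (F ^^ n) x \<in> I (itinerary x n)"
  by (auto simp: itinerary_def \<Lambda>_def)

lemma itinerary_shift: "itinerary (F x) = shift (itinerary x)"
  by (auto simp: itinerary_def shift_def funpow_swap1 fun_eq_iff)

lemma itinerary_eqI:
  assumes "s \<in> Sigma2" and "\<And>n. (F ^^ n) x \<in> I (s n)"
  shows "x \<in> \<Lambda>" and "itinerary x = s"
proof -
  have s: "s n = 1 \<or> s n = 2" for n
    using assms(1) by (auto simp: Sigma2_def)
  show "x \<in> \<Lambda>"
  proof -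
    have "(F ^^ n) x \<in> I 1 \<union> I 2" for n
      using assms(2)[of n] s[of n] by auto
    then show ?thesis by (simp add: \<Lambda>_def)
  qed
  show "itinerary x = s"
  proof
    fix n
    show "itinerary x n = s n"
      using assms(2)[of n] s[of n] disjoint by (auto simp: itinerary_def)
  qed
qed

text \<open>
  The mean value theorem turns the derivative bound into expansion of distances; convexity keeps
  the intermediate point in the segment.
\<close>

lemma expands_on_piece:
  assumes "i \<in> {1, 2}" "x \<in> I i" "y \<in> I i"
  shows "\<mu> * \<bar>x - y\<bar> \<le> \<bar>F x - F y\<bar>"
proof -
  have *: "\<mu> * \<bar>x - y\<bar> \<le> \<bar>F x - F y\<bar>" if "x < y" "x \<in> I i" "y \<in> I i" for x y
  proof -
    obtain z where z: "z > x" "z < y" "F y - F x = (y - x) * F' z"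
      using MVT2[OF \<open>x < y\<close>, of F F'] deriv by blast
    have "z \<in> I i"
      using convex_piece[OF assms(1)] z that is_interval_convex_1 mem_is_interval_1_I
      by (metis less_imp_le)
    then have "\<mu> \<le> \<bar>F' z\<bar>"
      using expands assms(1) by auto
    then have "\<mu> * \<bar>y - x\<bar> \<le> \<bar>F' z\<bar> * \<bar>y - x\<bar>"
      by (intro mult_right_mono) auto
    then show ?thesis
      by (simp add: abs_minus_commute[of "F x"] z(3) abs_mult mult.commute abs_minus_commute[of x])
  qed
  show ?thesis
    using *[of x y] *[of y x] assms by (cases x y rule: linorder_cases) (auto simp: abs_minus_commute)
qed

text \<open>
  Two points with the same itinerary lie in a common segment at every time, so their distance grows
  at least by the factor \<open>\<mu>\<close> in each step. In the bounded set \<open>\<Lambda>\<close> this forces them to coincide.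
\<close>

lemma inj_itinerary: "inj_on itinerary \<Lambda>"
proof (rule inj_onI, rule ccontr)
  fix x y assume x: "x \<in> \<Lambda>" and y: "y \<in> \<Lambda>" and eq: "itinerary x = itinerary y" and "x \<noteq> y"
  have grow: "\<mu> ^ n * \<bar>x - y\<bar> \<le> \<bar>(F ^^ n) x - (F ^^ n) y\<bar>" for n
  proof (induction n)
    case (Suc n)
    have "itinerary x n \<in> {1, 2}" by (simp add: itinerary_def)
    then have "\<mu> * \<bar>(F ^^ n) x - (F ^^ n) y\<bar> \<le> \<bar>(F ^^ Suc n) x - (F ^^ Suc n) y\<bar>"
      using expands_on_piece in_piece_itinerary[OF x] in_piece_itinerary[OF y] eq by simp
    moreover have "\<mu> * (\<mu> ^ n * \<bar>x - y\<bar>) \<le> \<mu> * \<bar>(F ^^ n) x - (F ^^ n) y\<bar>"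
      using Suc \<mu> by (intro mult_left_mono) auto
    ultimately show ?case by simp
  qed simp
  obtain B where B: "\<And>z. z \<in> \<Lambda> \<Longrightarrow> \<bar>z\<bar> \<le> B"
    using compact_imp_bounded[OF compact_\<Lambda>] by (auto simp: bounded_iff)
  obtain n where "2 * B / \<bar>x - y\<bar> < \<mu> ^ n"
    using real_arch_pow[OF \<mu>] by blast
  then have "2 * B < \<mu> ^ n * \<bar>x - y\<bar>"
    using \<open>x \<noteq> y\<close> by (simp add: field_simps)
  moreover have "\<bar>(F ^^ n) x - (F ^^ n) y\<bar> \<le> 2 * B"
    using B[OF iterate_in_\<Lambda>[OF x, of n]] B[OF iterate_in_\<Lambda>[OF y, of n]] by linarith
  ultimately show False using grow[of n] by linarith
qed

text \<open>
  Pull back one symbol at a time: a point that realises the tail of \<open>s\<close> lies in one of the two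
  segments, hence has a preimage in the segment that the first symbol prescribes.
\<close>

lemma finite_itinerary_realised:
  assumes "s \<in> Sigma2"
  shows "\<exists>x. \<forall>i\<le>n. (F ^^ i) x \<in> I (s i)"
  using assms
proof (induction n arbitrary: s)
  case 0
  have "I (s 0) \<noteq> {}"
    using covers[of "s 0"] nonempty 0 by (auto simp: Sigma2_def)
  then show ?case by auto
next
  case (Suc n)
  have s: "s i \<in> {1, 2}" for i
    using Suc.prems unfolding Sigma2_def by blast
  then have "shift s \<in> Sigma2" by (auto simp: shift_def Sigma2_def)
  then obtain y where y: "\<forall>i\<le>n. (F ^^ i) y \<in> I (s (Suc i))"
    using Suc.IH unfolding shift_def by blast
  then have "y \<in> I 1 \<union> I 2" using s[of 1] by fastforce
  then obtain x where x: "x \<in> I (s 0)" "y = F x"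
    using covers[OF s] by blast
  have "(F ^^ i) x \<in> I (s i)" if "i \<le> Suc n" for i
    using x y that by (cases i) (auto simp: funpow_swap1)
  then show ?case by blast
qed

lemma itinerary_surj: "itinerary ` \<Lambda> = Sigma2"
proof (intro equalityI subsetI)
  fix s assume s: "s \<in> Sigma2"
  then have s12: "s i \<in> {1, 2}" for i
    unfolding Sigma2_def by blast
  \<comment> \<open>Points with the right first \<open>n + 1\<close> symbols. The factor \<open>I (s 0)\<close> repeats the condition for
     \<open>i = 0\<close> in a form that displays compactness.\<close>
  define C where "C n = I (s 0) \<inter> (\<Inter>i\<le>n. (F ^^ i) -` I (s i))" for n
  have "\<Inter> (range C) \<noteq> {}"
  proof (rule compact_nest)
    show "compact (C n)" for n
      unfolding C_def
      by (intro compact_Int_closed closed_INT ballI closed_iterate_vimage closed_piece compact_piece s12)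
    show "C n \<noteq> {}" for n
      using finite_itinerary_realised[OF s, of n] unfolding C_def by fastforce
    show "C n \<subseteq> C k" if "k \<le> n" for k n
      using that unfolding C_def by fastforce
  qed
  then obtain x where "\<And>n. (F ^^ n) x \<in> I (s n)"
    unfolding C_def by auto
  then show "s \<in> itinerary ` \<Lambda>"
    using itinerary_eqI[OF s] by blast
qed (use itinerary_in_Sigma2 in auto)

lemma continuous_itinerary: "continuous_map (top_of_set \<Lambda>) Sigma2.mtopology itinerary"
  unfolding Sigma2.continuous_map_to_metric
proof (intro ballI allI impI)
  fix x and \<epsilon> :: real assume "x \<in> topspace (top_of_set \<Lambda>)" and "\<epsilon> > 0"
  then have x: "x \<in> \<Lambda>" by simp
  obtain n where n: "(1/2::real) ^ n < \<epsilon> / 2"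
    using real_arch_pow_inv[of "\<epsilon> / 2" "1/2"] \<open>\<epsilon> > 0\<close> by auto
  \<comment> \<open>Avoiding the closed segment with the other symbol (\<open>3 - i\<close> exchanges 1 and 2) is an open
     condition, and within \<open>\<Lambda>\<close> it fixes the symbol.\<close>
  define V where "V = (\<Inter>i<n. - ((F ^^ i) -` I (3 - itinerary x i)))"
  have agree: "itinerary y i = itinerary x i \<longleftrightarrow> (F ^^ i) y \<notin> I (3 - itinerary x i)" if "y \<in> \<Lambda>" for y i
    using that disjoint by (auto simp: itinerary_def \<Lambda>_def)
  have "open V"
    unfolding V_def
    by (intro open_INT ballI open_Compl closed_iterate_vimage closed_piece)
      (auto simp: itinerary_def)
  show "\<exists>U. openin (top_of_set \<Lambda>) U \<and> x \<in> U \<and> (\<forall>y\<in>U. itinerary y \<in> Sigma2.mball (itinerary x) \<epsilon>)"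
  proof (intro exI[of _ "\<Lambda> \<inter> V"] conjI ballI)
    show "openin (top_of_set \<Lambda>) (\<Lambda> \<inter> V)"
      using \<open>open V\<close> by (rule openin_open_Int)
    show "x \<in> \<Lambda> \<inter> V"
      using x agree[OF x] by (auto simp: V_def)
    fix y assume "y \<in> \<Lambda> \<inter> V"
    then have "itinerary x i = itinerary y i" if "i < n" for i
      using agree[of y i] that unfolding V_def by fastforce
    then have "seq_dist (itinerary x) (itinerary y) \<le> 2 * (1/2) ^ n"
      by (rule seq_dist_le_if_agree)
    then show "itinerary y \<in> Sigma2.mball (itinerary x) \<epsilon>"
      using n itinerary_in_Sigma2 by simp
  qed
qed

lemma conjugate_to_shift: "topologically_conjugate (top_of_set \<Lambda>) F Sigma2.mtopology shift"
  unfolding topologically_conjugate_def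
proof (intro exI[of _ itinerary] conjI ballI)
  show "homeomorphic_map (top_of_set \<Lambda>) Sigma2.mtopology itinerary"
    using continuous_itinerary compact_\<Lambda> itinerary_surj inj_itinerary
    by (intro continuous_imp_homeomorphic_map Sigma2.Hausdorff_space_mtopology)
      (auto simp: compact_space_subtopology)
qed (simp add: itinerary_shift)

end

section \<open>Polynomials near a zero\<close>

text \<open>
  One derivative of \<open>(x - c)\<^sup>n\<^sup>+\<^sup>1 h\<close> is \<open>(x - c)\<^sup>n\<close> times \<open>(n + 1) h + (x - c) h'\<close>, and this new
  cofactor has the value \<open>(n + 1) h(c)\<close> at \<open>c\<close>.
\<close>

lemma pderiv_funpow_at_root:
  fixes h :: "real poly"
  shows "poly ((pderiv ^^ n) ([:-c, 1:] ^ n * h)) c = fact n * poly h c"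
proof (induction n arbitrary: h)
  case (Suc n)
  have "pderiv ([:-c, 1:] ^ Suc n * h) = [:-c, 1:] ^ n * (of_nat (Suc n) * h + [:-c, 1:] * pderiv h)"
    by (simp only: pderiv_mult pderiv_power_Suc) (simp add: pderiv_pCons algebra_simps of_nat_poly)
  then have "poly ((pderiv ^^ Suc n) ([:-c, 1:] ^ Suc n * h)) c
      = poly ((pderiv ^^ n) ([:-c, 1:] ^ n * (of_nat (Suc n) * h + [:-c, 1:] * pderiv h))) c"
    by (simp only: funpow_Suc_right o_apply)
  also have "\<dots> = fact n * poly (of_nat (Suc n) * h + [:-c, 1:] * pderiv h) c"
    by (rule Suc)
  also have "\<dots> = fact (Suc n) * poly h c"
    by simp
  finally show ?case .
qed simp

text \<open>
  Write \<open>g = (x - c)\<^sup>n h\<close> with \<open>h(c) \<noteq> 0\<close>. Near \<open>c\<close> the sign of \<open>h\<close> is that of \<open>h(c)\<close>, that is, of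
  the \<open>n\<close>-th derivative of \<open>g\<close> at \<open>c\<close>; and \<open>g'/g = n/(x - c) + h'/h\<close>, where the second term stays
  bounded while the first one exceeds every bound.
\<close>

lemma poly_near_root:
  fixes g :: "real poly"
  assumes "g \<noteq> 0" "poly g c = 0"
  defines "n \<equiv> order c g"
  obtains d where "d > 0"
    "\<And>x. x \<noteq> c \<Longrightarrow> \<bar>x - c\<bar> \<le> d \<Longrightarrow> 0 < poly g x * ((x - c) ^ n * poly ((pderiv ^^ n) g) c)"
    "\<And>x. x \<noteq> c \<Longrightarrow> \<bar>x - c\<bar> \<le> d \<Longrightarrow> K \<le> sgn (x - c) * (poly (pderiv g) x / poly g x)"
proof -
  obtain h where g: "g = [:-c, 1:] ^ n * h" and "\<not> [:-c, 1:] dvd h"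
    using order_decomp[OF \<open>g \<noteq> 0\<close>] unfolding n_def by blast
  then have h: "poly h c \<noteq> 0" by (simp add: poly_eq_0_iff_dvd)
  have "n > 0"
    using assms order_root unfolding n_def by blast
  then obtain k where k: "n = Suc k" using gr0_implies_Suc by blast
  \<comment> \<open>\<open>?B\<close> is \<open>\<bar>x - c\<bar>\<close> times a lower bound for the excess of the signed logarithmic derivative
     over \<open>K\<close>; unlike the quotient it is continuous at \<open>c\<close>.\<close>
  let ?A = "\<lambda>x. poly h x * poly h c"
  let ?B = "\<lambda>x. n - \<bar>x - c\<bar> * (K + \<bar>poly (pderiv h) x / poly h x\<bar>)"
  have "isCont ?A c" "isCont ?B c"
    using h by (intro continuous_intros; simp)+
  then have "?A \<midarrow>c\<rightarrow> ?A c" "?B \<midarrow>c\<rightarrow> ?B c"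
    by (simp_all only: isCont_def)
  moreover have "0 < ?A c" "0 < ?B c"
    using h \<open>n > 0\<close> by (auto simp: zero_less_mult_iff)
  ultimately have "eventually (\<lambda>x. 0 < ?A x) (at c)" "eventually (\<lambda>x. 0 < ?B x) (at c)"
    by (simp_all only: order_tendstoD(1))
  then have "eventually (\<lambda>x. 0 < ?A x \<and> 0 < ?B x) (at c)"
    by (rule eventually_conj)
  then obtain d where d: "d > 0" "\<And>x. x \<noteq> c \<Longrightarrow> \<bar>x - c\<bar> < d \<Longrightarrow> 0 < ?A x \<and> 0 < ?B x"
    unfolding eventually_at dist_real_def by blast
  show thesis
  proof
    show "d / 2 > 0" using d by simp
    fix x assume x: "x \<noteq> c" "\<bar>x - c\<bar> \<le> d / 2"
    then have AB: "0 < ?A x" "0 < ?B x" using d(2)[of x] d(1) by auto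
    have hx: "poly h x \<noteq> 0" using AB(1) by auto
    have gx: "poly g x = (x - c) ^ n * poly h x" by (subst g) simp
    have gn: "poly ((pderiv ^^ n) g) c = fact n * poly h c"
      using pderiv_funpow_at_root[of n c h] g by simp
    have "poly g x * ((x - c) ^ n * poly ((pderiv ^^ n) g) c) = ((x - c) ^ n)\<^sup>2 * (fact n * ?A x)"
      unfolding gx gn by (simp add: power2_eq_square)
    also have "\<dots> > 0" using AB x by simp
    finally show "0 < poly g x * ((x - c) ^ n * poly ((pderiv ^^ n) g) c)" .
    have "poly (pderiv g) x = n * (x - c) ^ k * poly h x + (x - c) ^ n * poly (pderiv h) x"
      by (subst g) (simp add: k pderiv_mult pderiv_power_Suc pderiv_pCons algebra_simps del: power_Suc of_nat_Suc)
      moreover have "(n * P * H + X * P * H') / (X * P * H) = n / X + H' / H"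
      if "X \<noteq> 0" "P \<noteq> 0" "H \<noteq> 0" for X P H H' :: real
      using that by (simp add: field_simps)
    ultimately have "poly (pderiv g) x / poly g x = n / (x - c) + poly (pderiv h) x / poly h x"
      unfolding gx using x hx by (simp add: k)
    then have "sgn (x - c) * (poly (pderiv g) x / poly g x)
        = n / \<bar>x - c\<bar> + sgn (x - c) * (poly (pderiv h) x / poly h x)"
      using x by (auto simp: sgn_if abs_if field_simps)
    moreover have "n / \<bar>x - c\<bar> > K + \<bar>poly (pderiv h) x / poly h x\<bar>"
      using AB(2) x by (simp add: field_simps)
    moreover have "\<bar>sgn (x - c) * (poly (pderiv h) x / poly h x)\<bar> = \<bar>poly (pderiv h) x / poly h x\<bar>"
      using x by (simp add: abs_mult)
    ultimately show "K \<le> sgn (x - c) * (poly (pderiv g) x / poly g x)" by linarith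
  qed
qed

lemma deriv_funpow_poly: "(deriv ^^ n) (poly p) = poly ((pderiv ^^ n) p)" for p :: "real poly"
proof (induction n)
  case (Suc n)
  have "deriv (poly q) = poly (pderiv q)" for q :: "real poly"
    by (rule ext) (rule DERIV_imp_deriv[OF poly_DERIV])
  then show ?case using Suc by simp
qed simp

section \<open>Steep branches beside a zero\<close>

text \<open>
  To the right of a zero at \<open>0\<close>, a lower bound \<open>K\<close> for the logarithmic derivative \<open>G'/G\<close> makes \<open>G\<close>
  increasing. The segment between the points of height \<open>lo\<close> and \<open>hi\<close> is thus mapped onto \<open>[lo, hi]\<close>
  and stays at height at least \<open>lo\<close>, so the slope there is at least \<open>K * lo\<close>, even when the
  zero is multiple and the slope tends to \<open>0\<close> on approaching it.
\<close>

lemma steep_segment: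
  fixes G G' :: "real \<Rightarrow> real"
  assumes deriv: "\<And>t. (G has_real_derivative G' t) (at t)"
    and "G 0 = 0" and "0 \<le> d" and "0 < lo" "lo < hi" "hi \<le> G d" and "0 \<le> K"
    and pos: "\<And>t. 0 < t \<Longrightarrow> t \<le> d \<Longrightarrow> 0 < G t"
    and steep: "\<And>t. 0 < t \<Longrightarrow> t \<le> d \<Longrightarrow> K * G t \<le> G' t"
  obtains u v where "0 < u" "v \<le> d" "{lo..hi} \<subseteq> G ` {u..v}"
    "\<And>t. t \<in> {u..v} \<Longrightarrow> K * lo \<le> G' t"
proof -
  have isCont: "isCont G t" for t
    using deriv DERIV_isCont by blast
  have mono: "G s \<le> G t" if "0 < s" "s \<le> t" "t \<le> d" for s t
  proof (rule DERIV_nonneg_imp_nondecreasing[OF \<open>s \<le> t\<close>])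
    fix x assume "s \<le> x" "x \<le> t"
    then have "0 \<le> K * G x" "K * G x \<le> G' x"
      using pos[of x] steep[of x] that \<open>0 \<le> K\<close> by auto
    then show "\<exists>y. (G has_real_derivative y) (at x) \<and> 0 \<le> y"
      using deriv by (meson order_trans)
  qed
  obtain u where u: "0 \<le> u" "u \<le> d" "G u = lo"
    using IVT[of G 0 lo d] assms isCont by auto
  obtain v where v: "0 \<le> v" "v \<le> d" "G v = hi"
    using IVT[of G 0 hi d] assms isCont by auto
  have "0 < u" "0 < v"
    using u v assms by (auto simp: less_le)
  have "u \<le> v"
    using mono[of v u] u v \<open>0 < v\<close> \<open>lo < hi\<close> by linarith
  have "{lo..hi} \<subseteq> G ` {u..v}"
  proof
    fix y assume "y \<in> {lo..hi}"
    then obtain t where "u \<le> t" "t \<le> v" "G t = y"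
      using IVT[of G u y v] u v \<open>u \<le> v\<close> isCont by auto
    then show "y \<in> G ` {u..v}" by auto
  qed
  moreover have "K * lo \<le> G' t" if "t \<in> {u..v}" for t
  proof -
    have t: "0 < t" "t \<le> d" "u \<le> t"
      using that \<open>0 < u\<close> v by auto
    have "K * lo \<le> K * G t"
      using mono[OF \<open>0 < u\<close> t(3,2)] u \<open>0 \<le> K\<close> by (intro mult_left_mono) auto
    then show ?thesis
      using steep[OF t(1,2)] by linarith
  qed
  ultimately show thesis
    using that \<open>0 < u\<close> v by blast
qed

text \<open>
  The same on either side of a zero \<open>c\<close>: \<open>e = 1\<close> for the right side, \<open>e = -1\<close> for the left, in the
  coordinate \<open>x = c + e * t\<close>.
\<close>

lemma steep_branch:
  fixes F F' :: "real \<Rightarrow> real"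
  assumes deriv: "\<And>x. (F has_real_derivative F' x) (at x)"
    and "F c = 0" and e: "e = 1 \<or> e = -1" and "0 \<le> d" and "0 < lo" "lo < hi" "hi \<le> F (c + e * d)" and "0 \<le> K"
    and pos: "\<And>x. 0 < e * (x - c) \<Longrightarrow> e * (x - c) \<le> d \<Longrightarrow> 0 < F x"
    and steep: "\<And>x. 0 < e * (x - c) \<Longrightarrow> e * (x - c) \<le> d \<Longrightarrow> K * F x \<le> e * F' x"
  obtains S where "compact S" "convex S" "\<And>x. x \<in> S \<Longrightarrow> 0 < e * (x - c) \<and> e * (x - c) \<le> d"
    "{lo..hi} \<subseteq> F ` S" "\<And>x. x \<in> S \<Longrightarrow> K * lo \<le> \<bar>F' x\<bar>"
proof -
  have der: "((\<lambda>t. F (c + e * t)) has_real_derivative e * F' (c + e * t)) (at t)" for t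
  proof -
    have "((\<lambda>t. c + e * t) has_real_derivative e) (at t)"
      by (auto intro!: derivative_eq_intros)
    from DERIV_chain2[OF deriv this] show ?thesis by (simp add: mult.commute)
  qed
  have unit: "e * (c + e * t - c) = t" for t
    using e by auto
  have zero: "F (c + e * 0) = 0"
    using \<open>F c = 0\<close> by simp
  obtain u v where uv: "0 < u" "v \<le> d" "{lo..hi} \<subseteq> (\<lambda>t. F (c + e * t)) ` {u..v}"
    "\<And>t. t \<in> {u..v} \<Longrightarrow> K * lo \<le> e * F' (c + e * t)"
    using steep_segment[OF der zero \<open>0 \<le> d\<close> \<open>0 < lo\<close> \<open>lo < hi\<close> \<open>hi \<le> F (c + e * d)\<close> \<open>0 \<le> K\<close>
        pos[of "c + e * _", unfolded unit] steep[of "c + e * _", unfolded unit]]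
    by blast
  define S where "S = (\<lambda>t. c + e * t) ` {u..v}"
  show thesis
  proof
    show "compact S"
      unfolding S_def by (intro compact_continuous_image continuous_intros) auto
    show "convex S"
      using convex_affinity[of "{u..v}" c e] by (simp add: S_def)
    show "{lo..hi} \<subseteq> F ` S"
      using uv(3) by (simp add: S_def image_image)
    show "0 < e * (x - c) \<and> e * (x - c) \<le> d" if "x \<in> S" for x
      using that uv(1,2) e by (auto simp: S_def)
    show "K * lo \<le> \<bar>F' x\<bar>" if "x \<in> S" for x
      using that uv(4) e by (force simp: S_def)
  qed
qed

section \<open>The horseshoe at two consecutive zeros\<close>

theorem theorem3p4:
  fixes g :: "real poly" and r i0 :: nat and \<alpha> :: "nat \<Rightarrow> real" and m :: "nat \<Rightarrow> nat"
    and f :: "real \<Rightarrow> real \<Rightarrow> real"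
  assumes monic: "lead_coeff g = 1"
    and zeros: "{x. poly g x = 0} = \<alpha> ` {1..r}"
    and increasing: "strict_mono_on {1..r} \<alpha>"
    and r: "2 \<le> r"
    and mult: "\<And>i. i \<in> {1..r} \<Longrightarrow> m i = order (\<alpha> i) g"
    and f: "\<And>a x. f a x = a * poly g x"
    and i0: "1 \<le> i0" "i0 < r"
    and pos: "\<alpha> i0 > 0"
    and odd: "odd (m i0)"
  shows "\<exists>N>0. \<forall>a. \<bar>a\<bar> > N \<and> (deriv ^^ m i0) (f a) (\<alpha> i0) < 0
            \<and> (deriv ^^ m (i0 + 1)) (f a) (\<alpha> (i0 + 1)) > 0 \<longrightarrow>
          (\<exists>\<Lambda>. invariant_set (f a) \<Lambda> \<and>
             \<Lambda> \<subseteq> einterval (ext_zero r \<alpha> (i0 - 1)) (ext_zero r \<alpha> i0) \<union>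
                  einterval (ext_zero r \<alpha> (i0 + 1)) (ext_zero r \<alpha> (i0 + 2)) \<and>
             hyperbolic_set (f a) \<Lambda> \<and>
             topologically_conjugate (top_of_set \<Lambda>) (f a) Sigma2.mtopology shift)"
proof -
  define p q where "p = \<alpha> i0" and "q = \<alpha> (i0 + 1)"
  have idx: "i0 \<in> {1..r}" "i0 + 1 \<in> {1..r}"
    using i0 by auto
  have root_iff: "poly g x = 0 \<longleftrightarrow> x \<in> \<alpha> ` {1..r}" for x
    using zeros by blast
  have "g \<noteq> 0" using monic by auto
  have "poly g p = 0" "poly g q = 0"
    using root_iff idx by (auto simp: p_def q_def)
  have "p > 0" using pos by (simp add: p_def)
  have "p < q"
    using strict_mono_onD[OF increasing idx] by (simp add: p_def q_def)
  obtain dp where dp: "dp > 0"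
    "\<And>x. x \<noteq> p \<Longrightarrow> \<bar>x - p\<bar> \<le> dp \<Longrightarrow> 0 < poly g x * ((x - p) ^ order p g * poly ((pderiv ^^ order p g) g) p)"
    "\<And>x. x \<noteq> p \<Longrightarrow> \<bar>x - p\<bar> \<le> dp \<Longrightarrow> 4 / p \<le> sgn (x - p) * (poly (pderiv g) x / poly g x)"
    using poly_near_root[OF \<open>g \<noteq> 0\<close> \<open>poly g p = 0\<close>, of "4 / p"] by blast
  obtain dq where dq: "dq > 0"
    "\<And>x. x \<noteq> q \<Longrightarrow> \<bar>x - q\<bar> \<le> dq \<Longrightarrow> 0 < poly g x * ((x - q) ^ order q g * poly ((pderiv ^^ order q g) g) q)"
    "\<And>x. x \<noteq> q \<Longrightarrow> \<bar>x - q\<bar> \<le> dq \<Longrightarrow> 4 / p \<le> sgn (x - q) * (poly (pderiv g) x / poly g x)"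
    using poly_near_root[OF \<open>g \<noteq> 0\<close> \<open>poly g q = 0\<close>, of "4 / p"] by blast
  \<comment> \<open>\<open>d \<le> p / 2\<close> keeps \<open>[p - d, q + d]\<close> above \<open>p / 2\<close>, which turns the bound \<open>4 / p\<close> on the
     logarithmic derivative into slope \<open>2\<close>.\<close>
  define d where "d = min (p / 2) (min dp dq)"
  have d: "0 < d" "d \<le> p / 2" "d \<le> dp" "d \<le> dq"
    using dp(1) dq(1) \<open>p > 0\<close> by (auto simp: d_def)
  have nz_left: "poly g x \<noteq> 0" if "p - d \<le> x" "x < p" for x
    using dp(2)[of x] that d by auto
  have nz_right: "poly g x \<noteq> 0" if "q < x" "x \<le> q + d" for x
    using dq(2)[of x] that d by auto
  \<comment> \<open>No further zero lies within \<open>d\<close>, so the neighbouring zeros, if any, are outside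
     \<open>[p - d, q + d]\<close>.\<close>
  have before: "ext_zero r \<alpha> (i0 - 1) < ereal (p - d)"
  proof (cases "i0 = 1")
    case False
    then have "i0 - 1 \<in> {1..r}" using i0 by auto
    moreover from this have "\<alpha> (i0 - 1) < p"
      using strict_mono_onD[OF increasing _ idx(1)] i0(1) by (simp add: p_def)
    ultimately have "\<alpha> (i0 - 1) < p - d"
      using nz_left[of "\<alpha> (i0 - 1)"] root_iff by force
    then show ?thesis using False i0 by (simp add: ext_zero_def)
  qed (simp add: ext_zero_def)
  have after: "ereal (q + d) < ext_zero r \<alpha> (i0 + 2)"
  proof (cases "i0 + 2 = r + 1")
    case False
    then have "i0 + 2 \<in> {1..r}" using i0 by auto
    moreover from this have "q < \<alpha> (i0 + 2)"
      using strict_mono_onD[OF increasing idx(2)] by (simp add: q_def)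
    ultimately have "q + d < \<alpha> (i0 + 2)"
      using nz_right[of "\<alpha> (i0 + 2)"] root_iff by force
    then show ?thesis using False by (simp add: ext_zero_def)
  qed (simp add: ext_zero_def)
  \<comment> \<open>The threshold from which on \<open>f\<^sub>a\<close> exceeds \<open>q + d\<close> in absolute value at both outer ends.\<close>
  define N where "N = (q + d) / min \<bar>poly g (p - d)\<bar> \<bar>poly g (q + d)\<bar>"
  have gd: "0 < min \<bar>poly g (p - d)\<bar> \<bar>poly g (q + d)\<bar>"
    using nz_left[of "p - d"] nz_right[of "q + d"] d by simp
  then have "N > 0"
    using \<open>p > 0\<close> \<open>p < q\<close> d by (simp add: N_def)
  show ?thesis
  proof (intro exI[of _ N] conjI allI impI \<open>N > 0\<close>)
    fix a assume a: "N < \<bar>a\<bar> \<and> (deriv ^^ m i0) (f a) (\<alpha> i0) < 0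
            \<and> (deriv ^^ m (i0 + 1)) (f a) (\<alpha> (i0 + 1)) > 0"
    define F F' where "F = poly (smult a g)" and "F' = poly (smult a (pderiv g))"
    have fa: "f a = F"
      using f by (auto simp: F_def)
    have der: "(F has_real_derivative F' x) (at x)" for x
      unfolding F_def F'_def pderiv_smult[symmetric] by (rule poly_DERIV)
    have "(pderiv ^^ n) (smult a g) = smult a ((pderiv ^^ n) g)" for n
      by (induction n) (auto simp: pderiv_smult)
    then have lead: "a * poly ((pderiv ^^ order p g) g) p < 0" "0 < a * poly ((pderiv ^^ order q g) g) q"
      using a mult[OF idx(1)] mult[OF idx(2)]
      by (auto simp: fa F_def deriv_funpow_poly p_def q_def)
    then have "a \<noteq> 0" by auto
    have scale: "0 < (a * s) * (t * (a * l))" if "0 < s * (t * l)" for s t l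
    proof -
      have "0 < a\<^sup>2 * (s * (t * l))" using that \<open>a \<noteq> 0\<close> by simp
      then show ?thesis by (simp add: power2_eq_square mult_ac)
    qed
    have pos_left: "0 < F x" if "0 < -1 * (x - p)" "-1 * (x - p) \<le> d" for x
    proof -
      have "0 < (a * poly g x) * ((x - p) ^ order p g * (a * poly ((pderiv ^^ order p g) g) p))"
        using that d by (intro scale dp(2)) auto
      moreover have "(x - p) ^ order p g < 0"
        using that odd mult[OF idx(1)] by (simp add: p_def power_less_zero_eq)
      ultimately show ?thesis
        using zero_less_mult_pos2 mult_neg_neg lead(1) unfolding F_def poly_smult by blast
    qed
    have pos_right: "0 < F x" if "0 < 1 * (x - q)" "1 * (x - q) \<le> d" for x
    proof -
      have "0 < (a * poly g x) * ((x - q) ^ order q g * (a * poly ((pderiv ^^ order q g) g) q))"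
        using that d by (intro scale dq(2)) auto
      moreover have "(x - q) ^ order q g > 0"
        using that by simp
      ultimately show ?thesis
        using zero_less_mult_pos2 mult_pos_pos lead(2) unfolding F_def poly_smult by blast
    qed
    have log_deriv: "4 / p * F x \<le> e * F' x"
      if "0 < F x" "4 / p \<le> e * (poly (pderiv g) x / poly g x)" for x e
    proof -
      have "4 / p * F x \<le> e * (poly (pderiv g) x / poly g x) * F x"
        using that by (intro mult_right_mono) auto
      also have "\<dots> = e * F' x"
        using that(1) by (auto simp: F_def F'_def)
      finally show ?thesis .
    qed
    have steep_left: "4 / p * F x \<le> -1 * F' x" if "0 < -1 * (x - p)" "-1 * (x - p) \<le> d" for x
      using log_deriv[OF pos_left[OF that], of "-1"] dp(3)[of x] that d by simp
    have steep_right: "4 / p * F x \<le> 1 * F' x" if "0 < 1 * (x - q)" "1 * (x - q) \<le> d" for x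
      using log_deriv[OF pos_right[OF that], of 1] dq(3)[of x] that d by simp
    have "q + d < \<bar>a\<bar> * min \<bar>poly g (p - d)\<bar> \<bar>poly g (q + d)\<bar>"
      using a gd by (simp add: N_def pos_divide_less_eq)
    then have "q + d < \<bar>a\<bar> * y" if "min \<bar>poly g (p - d)\<bar> \<bar>poly g (q + d)\<bar> \<le> y" for y
      using mult_left_mono[OF that, of "\<bar>a\<bar>"] by linarith
    from this[of "\<bar>poly g (p - d)\<bar>"] this[of "\<bar>poly g (q + d)\<bar>"]
    have "q + d \<le> \<bar>F (p - d)\<bar>" "q + d \<le> \<bar>F (q + d)\<bar>"
      by (simp_all add: F_def abs_mult)
    then have high: "q + d \<le> F (p + -1 * d)" "q + d \<le> F (q + 1 * d)"
      using pos_left[of "p - d"] pos_right[of "q + d"] d(1) by auto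
    have range: "0 < p - d" "p - d < q + d" "0 \<le> d" "0 \<le> 4 / p"
      using d \<open>p > 0\<close> \<open>p < q\<close> by auto
    have F0: "F p = 0" "F q = 0"
      using \<open>poly g p = 0\<close> \<open>poly g q = 0\<close> by (auto simp: F_def)
    obtain L where L: "compact L" "convex L" "\<And>x. x \<in> L \<Longrightarrow> 0 < -1 * (x - p) \<and> -1 * (x - p) \<le> d"
      "{p - d..q + d} \<subseteq> F ` L" "\<And>x. x \<in> L \<Longrightarrow> 4 / p * (p - d) \<le> \<bar>F' x\<bar>"
      using steep_branch[OF der F0(1) _ range(3,1,2) high(1) range(4) pos_left steep_left] by blast
    obtain R where R: "compact R" "convex R" "\<And>x. x \<in> R \<Longrightarrow> 0 < 1 * (x - q) \<and> 1 * (x - q) \<le> d"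
      "{p - d..q + d} \<subseteq> F ` R" "\<And>x. x \<in> R \<Longrightarrow> 4 / p * (p - d) \<le> \<bar>F' x\<bar>"
      using steep_branch[OF der F0(2) _ range(3,1,2) high(2) range(4) pos_right steep_right] by blast
    have inL: "p - d \<le> x \<and> x < p" if "x \<in> L" for x
      using L(3)[OF that] by auto
    have inR: "q < x \<and> x \<le> q + d" if "x \<in> R" for x
      using R(3)[OF that] by auto
    have sub: "L \<union> R \<subseteq> {p - d..q + d}"
      using inL inR \<open>p < q\<close> d(1) by fastforce
    have two: "2 \<le> 4 / p * (p - d)"
      using d(2) \<open>p > 0\<close> by (simp add: field_simps)
    define I :: "nat \<Rightarrow> real set" where "I i = (if i = 1 then L else R)" for i
    interpret expanding_horseshoe F F' I 2
    proof
      show "continuous_on UNIV F'"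
        unfolding F'_def by (intro continuous_intros)
      show "I 1 \<noteq> {}"
        using L(4) range(2) by (auto simp: I_def)
      show "I 1 \<inter> I 2 = {}"
        using inL inR \<open>p < q\<close> by (fastforce simp: I_def)
      show "I 1 \<union> I 2 \<subseteq> F ` I i" if "i \<in> {1, 2}" for i
        using sub L(4) R(4) by (auto simp: I_def)
      show "2 \<le> \<bar>F' x\<bar>" if "x \<in> I 1 \<union> I 2" for x
        using that L(5)[of x] R(5)[of x] two by (auto simp: I_def)
    qed (use der L R in \<open>auto simp: I_def\<close>)
    have "\<Lambda> \<subseteq> L \<union> R"
      using \<Lambda>_step by (auto simp: I_def)
    also have "\<dots> \<subseteq> einterval (ext_zero r \<alpha> (i0 - 1)) (ext_zero r \<alpha> i0) \<union>
                  einterval (ext_zero r \<alpha> (i0 + 1)) (ext_zero r \<alpha> (i0 + 2))"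
    proof (intro Un_mono subsetI)
      fix x assume "x \<in> L"
      then have "ereal (p - d) \<le> ereal x" "ereal x < ext_zero r \<alpha> i0"
        using inL[of x] i0 by (auto simp: ext_zero_def p_def)
      then show "x \<in> einterval (ext_zero r \<alpha> (i0 - 1)) (ext_zero r \<alpha> i0)"
        using less_le_trans[OF before] by (simp add: einterval_iff)
    next
      fix x assume "x \<in> R"
      then have "ereal x \<le> ereal (q + d)" "ext_zero r \<alpha> (i0 + 1) < ereal x"
        using inR[of x] i0 by (auto simp: ext_zero_def q_def)
      then show "x \<in> einterval (ext_zero r \<alpha> (i0 + 1)) (ext_zero r \<alpha> (i0 + 2))"
        using le_less_trans[OF _ after] by (simp add: einterval_iff)
    qed
    finally show "\<exists>\<Lambda>. invariant_set (f a) \<Lambda> \<and>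
             \<Lambda> \<subseteq> einterval (ext_zero r \<alpha> (i0 - 1)) (ext_zero r \<alpha> i0) \<union>
                  einterval (ext_zero r \<alpha> (i0 + 1)) (ext_zero r \<alpha> (i0 + 2)) \<and>
             hyperbolic_set (f a) \<Lambda> \<and>
             topologically_conjugate (top_of_set \<Lambda>) (f a) Sigma2.mtopology shift"
      unfolding fa using invariant hyperbolic conjugate_to_shift by blast
  qed
qed

end
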